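(* Let $n\ge4$ and let $CS$ be the cyclic shift strategy of length $n$. Then the number of permutations $\pi\in S_n$ such that the game with strategy $CS$ and secret $\pi$ ends after exactly three guesses and $\rho_{CS}(\pi)=2$ equals $2^n-2n-2$.
   Context: Permutation wordle on $[n]=\{1,\dots,n\}$: a secret permutation $\pi\in S_n$ (one-line notation) is fixed. The first guess is $\gamma_1=[1,2,\dots,n]$. After guess $\gamma_r$ the guesser learns $\mathcal{J}_r=\{i:\gamma_r(i)=\pi(i)\}$; $\mathcal{I}_r=[n]\setminus\mathcal{J}_r$. The game ends at the first $r$ with $\mathcal{J}_r=[n]$. A strategy of length $n$ is a sequence $S=(S[1],\dots,S[n])$ with $S[k]$ a permutation of $[k]$; if $\mathcal{I}_r=\{i_1<\dots<i_k\}\neq\emptyset$ and $\sigma=S[k]$, then $\gamma_{r+1}(i)=\gamma_r(i)$ for $i\in\mathcal{J}_r$ and $\gamma_{r+1}(i_{\sigma(j)})=\gamma_r(i_j)$ for $j=1,\dots,k$. The cyclic shift strategy $CS$ has $CS[k]=[2,3,\dots,k,1]$ for every $k$. For a secret $\pi$, $\rho_S(\pi)=\min\{i:\mathcal{J}_i\neq\emptyset\}$. *)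

theory Defs
  imports "HOL-Combinatorics.Permutations"
begin

text \<open>
  Permutations of \<open>{1..n}\<close> are functions \<open>p :: nat \<Rightarrow> nat\<close> with \<^term>\<open>p permutes {1..n}\<close>;
  the one-line notation of \<open>p\<close> is \<open>[p 1, \<dots>, p n]\<close>.
  A strategy \<open>S\<close> is a function with \<open>S k\<close> in the role of \<open>S[k]\<close>; for a game on \<open>{1..n}\<close>
  only its values at \<open>k \<in> {1..n}\<close> matter.
\<close>

definition strategy :: "nat \<Rightarrow> (nat \<Rightarrow> nat \<Rightarrow> nat) \<Rightarrow> bool" where
  "strategy n S \<longleftrightarrow> (\<forall>k\<in>{1..n}. S k permutes {1..k})"

definition cyclic_shift :: "nat \<Rightarrow> nat \<Rightarrow> nat" where
  "cyclic_shift k j = (if j \<in> {1..k} then if j < k then j + 1 else 1 else j)"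

definition correct :: "nat \<Rightarrow> (nat \<Rightarrow> nat) \<Rightarrow> (nat \<Rightarrow> nat) \<Rightarrow> nat set" where
  "correct n \<pi> g = {i \<in> {1..n}. g i = \<pi> i}"

definition incorrect :: "nat \<Rightarrow> (nat \<Rightarrow> nat) \<Rightarrow> (nat \<Rightarrow> nat) \<Rightarrow> nat set" where
  "incorrect n \<pi> g = {1..n} - correct n \<pi> g"

text \<open>The \<open>j\<close>-th smallest element \<open>i\<^sub>j\<close> of a finite set \<open>I\<close>, for \<open>1 \<le> j \<le> card I\<close>.\<close>

definition elem_at :: "nat set \<Rightarrow> nat \<Rightarrow> nat" where
  "elem_at I j = sorted_list_of_set I ! (j - 1)"

text \<open>
  The rule \<open>\<gamma>\<^bsub>r+1\<^esub>(i\<^bsub>\<sigma>(j)\<^esub>) = \<gamma>\<^sub>r(i\<^sub>j)\<close> is solved for \<open>i = i\<^bsub>\<sigma>(j)\<^esub>\<close>; the original form is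
  lemma \<open>next_guess_incorrect\<close> below. A completely correct guess is repeated
  forever, so that every \<open>\<gamma>\<^sub>r\<close> with \<open>r \<ge> 1\<close> is defined.
\<close>

definition next_guess ::
  "nat \<Rightarrow> (nat \<Rightarrow> nat \<Rightarrow> nat) \<Rightarrow> (nat \<Rightarrow> nat) \<Rightarrow> (nat \<Rightarrow> nat) \<Rightarrow> nat \<Rightarrow> nat" where
  "next_guess n S \<pi> g =
     (let I = incorrect n \<pi> g; k = card I; \<sigma> = S k in
      (\<lambda>i. if i \<in> I then g (elem_at I (THE j. j \<in> {1..k} \<and> elem_at I (\<sigma> j) = i)) else g i))"

text \<open>Guesses are numbered from 1; index 0 is not used.\<close>

definition guess :: "nat \<Rightarrow> (nat \<Rightarrow> nat \<Rightarrow> nat) \<Rightarrow> (nat \<Rightarrow> nat) \<Rightarrow> nat \<Rightarrow> nat \<Rightarrow> nat" where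
  "guess n S \<pi> r = (next_guess n S \<pi> ^^ (r - 1)) id"

definition ends_after :: "nat \<Rightarrow> (nat \<Rightarrow> nat \<Rightarrow> nat) \<Rightarrow> (nat \<Rightarrow> nat) \<Rightarrow> nat \<Rightarrow> bool" where
  "ends_after n S \<pi> r \<longleftrightarrow>
     1 \<le> r \<and> correct n \<pi> (guess n S \<pi> r) = {1..n} \<and>
     (\<forall>s. 1 \<le> s \<and> s < r \<longrightarrow> correct n \<pi> (guess n S \<pi> s) \<noteq> {1..n})"

text \<open>Unspecified if no guess ever has a correct entry, which is impossible in a game that ends
  (for \<open>n \<ge> 1\<close>).\<close>

definition rho :: "nat \<Rightarrow> (nat \<Rightarrow> nat \<Rightarrow> nat) \<Rightarrow> (nat \<Rightarrow> nat) \<Rightarrow> nat" where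
  "rho n S \<pi> = (LEAST r. 1 \<le> r \<and> correct n \<pi> (guess n S \<pi> r) \<noteq> {})"

lemma strategy_cyclic_shift: "strategy n cyclic_shift"
  unfolding strategy_def
proof
  fix k assume "k \<in> {1..n}"
  have inj: "inj_on (cyclic_shift k) {1..k}"
    by (auto simp: inj_on_def cyclic_shift_def split: if_splits)
  have sub: "cyclic_shift k ` {1..k} \<subseteq> {1..k}"
    by (auto simp: cyclic_shift_def)
  have "bij_betw (cyclic_shift k) {1..k} {1..k}"
    using inj sub by (simp add: bij_betw_def endo_inj_surj)
  then show "cyclic_shift k permutes {1..k}"
    by (rule bij_imp_permutes) (auto simp: cyclic_shift_def)
qed

lemma elem_at_bij:
  assumes "finite I"
  shows "bij_betw (elem_at I) {1..card I} I"
proof -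
  have "bij_betw (\<lambda>j. j - 1) {1..card I} {..<card I}"
    by (rule bij_betw_byWitness[where f' = Suc]) auto
  moreover have "bij_betw ((!) (sorted_list_of_set I)) {..<card I} I"
    using assms by (intro bij_betw_nth) auto
  ultimately have "bij_betw ((!) (sorted_list_of_set I) \<circ> (\<lambda>j. j - 1)) {1..card I} I"
    by (rule bij_betw_trans)
  then show ?thesis
    by (simp add: elem_at_def[abs_def] comp_def)
qed

lemma next_guess_correct: "i \<in> correct n \<pi> g \<Longrightarrow> next_guess n S \<pi> g i = g i"
  by (simp add: next_guess_def incorrect_def Let_def)

lemma next_guess_incorrect:
  fixes n :: nat and \<pi> g :: "nat \<Rightarrow> nat"
  defines "I \<equiv> incorrect n \<pi> g"
  assumes S: "S (card I) permutes {1..card I}" and j: "j \<in> {1..card I}"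
  shows "next_guess n S \<pi> g (elem_at I (S (card I) j)) = g (elem_at I j)"
proof -
  let ?s = "S (card I)"
  have "finite I" by (simp add: I_def incorrect_def)
  note bij = elem_at_bij[OF this]
  have s: "?s m \<in> {1..card I} \<longleftrightarrow> m \<in> {1..card I}" for m
    using permutes_in_image[OF S] .
  have "elem_at I (?s j) \<in> I"
    using bij s j by (auto simp: bij_betw_def)
  moreover have "(THE m. m \<in> {1..card I} \<and> elem_at I (?s m) = elem_at I (?s j)) = j"
  proof (rule the_equality)
    fix m assume m: "m \<in> {1..card I} \<and> elem_at I (?s m) = elem_at I (?s j)"
    then have "?s m = ?s j"
      using bij_betw_imp_inj_on[OF bij] s j by (meson inj_onD)
    then show "m = j"
      using permutes_inj[OF S] by (simp add: inj_eq)
  qed (use j in simp)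
  ultimately show ?thesis
    by (simp add: next_guess_def Let_def I_def[symmetric])
qed

end

theory Submission
  imports Defs
begin

text \<open>
  Let \<open>c\<^sub>I\<close> be the cyclic predecessor map of \<open>I\<close>, extended by the identity. A step of the
  cyclic shift strategy replaces the guess \<open>g\<close> by \<open>g \<circ> c\<^sub>I\<close>, where \<open>I\<close> is the set of incorrect
  positions. Hence a secret that is first touched by the second guess and found by the third one
  is \<open>c\<^sub>U \<circ> c\<^sub>I\<close> with \<open>U = {1..n}\<close> and \<open>I\<close> the set of incorrect positions of the second guess.
  Conversely, a proper subset \<open>I\<close> of \<open>U\<close> arises in this way iff \<open>c\<^sub>I\<close> moves every point of \<open>I\<close>,
  which means \<open>card I \<ge> 2\<close>, and \<open>c\<^sub>U \<circ> c\<^sub>I\<close> has no fixed point, which excludes just the \<open>n\<close>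
  pairs of cyclic neighbours. This leaves \<open>2 ^ n - 1 - 1 - n - n\<close> sets \<open>I\<close>.
\<close>

section \<open>Cyclic predecessors in a finite set of numbers\<close>

definition cyclic_pred :: "nat set \<Rightarrow> nat \<Rightarrow> nat" where
  "cyclic_pred I i =
     (if i \<notin> I then i else if i = Min I then Max I else Max {j \<in> I. j < i})"

text \<open>The relational counterpart of \<open>cyclic_pred\<close>. Its second disjunct is the
  wrap-around from the maximum to the minimum and allows \<open>p = i\<close> in a singleton.
  Without \<open>Min\<close> and \<open>Max\<close>, uniqueness on either side is a matter of linear
  arithmetic.\<close>

definition precedes :: "nat set \<Rightarrow> nat \<Rightarrow> nat \<Rightarrow> bool" where
  "precedes I p i \<longleftrightarrow> p \<in> I \<and> i \<in> I \<and>
     (p < i \<and> (\<forall>x\<in>I. x \<le> p \<or> i \<le> x) \<or> (\<forall>x\<in>I. i \<le> x \<and> x \<le> p))"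

lemma precedes_cyclic_pred:
  assumes "finite I" "i \<in> I"
  shows "precedes I (cyclic_pred I i) i"
proof (cases "i = Min I")
  case True
  moreover have "Max I \<in> I"
    using assms Max_in by blast
  ultimately show ?thesis
    using assms by (auto simp: precedes_def cyclic_pred_def)
next
  case False
  let ?J = "{j \<in> I. j < i}"
  have "Min I < i"
    using False assms by (simp add: order_less_le)
  then have ne: "?J \<noteq> {}"
    using assms Min_in by blast
  have fin: "finite ?J"
    using assms by simp
  have "x \<le> Max ?J \<or> i \<le> x" if "x \<in> I" for x
    using that fin by (cases "x < i") auto
  moreover have "Max ?J \<in> I" "Max ?J < i"
    using Max_in[OF fin ne] by auto
  moreover have "cyclic_pred I i = Max ?J"
    using False assms by (simp add: cyclic_pred_def)
  ultimately show ?thesis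
    using assms by (simp add: precedes_def)
qed

lemma precedes_unique_left:
  assumes "precedes I p i" "precedes I q i"
  shows "p = q"
proof -
  have "p < i \<and> (q \<le> p \<or> i \<le> q) \<or> i \<le> q \<and> q \<le> p"
    "q < i \<and> (p \<le> q \<or> i \<le> p) \<or> i \<le> p \<and> p \<le> q"
    using assms unfolding precedes_def by blast+
  then show ?thesis
    by linarith
qed

lemma precedes_unique_right:
  assumes "precedes I p i" "precedes I p j"
  shows "i = j"
proof -
  have "p < i \<and> (j \<le> p \<or> i \<le> j) \<or> i \<le> j \<and> j \<le> p"
    "p < j \<and> (i \<le> p \<or> j \<le> i) \<or> j \<le> i \<and> i \<le> p"
    using assms unfolding precedes_def by blast+
  then show ?thesis
    by linarith
qed

lemma cyclic_pred_eq:
  assumes "finite I" "precedes I p i"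
  shows "cyclic_pred I i = p"
proof -
  have "i \<in> I"
    using assms(2) by (simp add: precedes_def)
  then show ?thesis
    using precedes_unique_left[OF precedes_cyclic_pred assms(2)] assms(1) by blast
qed

lemma cyclic_pred_outside: "i \<notin> I \<Longrightarrow> cyclic_pred I i = i"
  by (simp add: cyclic_pred_def)

lemma cyclic_pred_permutes:
  assumes "finite I"
  shows "cyclic_pred I permutes I"
proof (rule bij_imp_permutes)
  have "inj_on (cyclic_pred I) I"
    using assms precedes_cyclic_pred precedes_unique_right by (metis inj_onI)
  moreover have "cyclic_pred I ` I \<subseteq> I"
    using precedes_cyclic_pred[OF assms] by (auto simp: precedes_def)
  ultimately show "bij_betw (cyclic_pred I) I I"
    using assms by (simp add: bij_betw_def endo_inj_surj)
qed (rule cyclic_pred_outside)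

text \<open>With \<open>p = i\<close> only the wrap-around case of \<open>precedes\<close> is
  possible, and it makes \<open>i\<close> both the least and the greatest element.\<close>

lemma cyclic_pred_fixpoint_imp_singleton:
  assumes "finite I" "i \<in> I" "cyclic_pred I i = i"
  shows "I = {i}"
proof -
  have "\<forall>x\<in>I. i \<le> x \<and> x \<le> i"
    using precedes_cyclic_pred[OF assms(1,2)] assms(3) by (simp add: precedes_def)
  then show ?thesis
    using assms(2) by (auto intro: le_antisym)
qed

lemma cyclic_pred_singleton: "cyclic_pred {i} = id"
  by (auto simp: cyclic_pred_def)

text \<open>The interval is written with \<open>Suc 0\<close>, the form to which the simplifier
  brings \<open>{1..n}\<close>, so that the equation can serve as a rewrite rule.\<close>

lemma cyclic_pred_interval:
  assumes "i \<in> {1..n}"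
  shows "cyclic_pred {Suc 0..n} i = (if i = 1 then n else i - 1)"
  using assms by (intro cyclic_pred_eq) (auto simp: precedes_def)

section \<open>The cyclic shift step as composition with the cyclic predecessor\<close>

lemma elem_at_less:
  assumes "1 \<le> j" "j < m" "m \<le> card I"
  shows "elem_at I j < elem_at I m"
  unfolding elem_at_def using assms
  by (intro sorted_wrt_nth_less[OF strict_sorted_list_of_set]) auto

text \<open>The game sends the value at index \<open>j\<close> to index
  \<open>cyclic_shift (card I) j\<close>. So each incorrect position receives the value of its
  cyclic predecessor; \<open>j = card I\<close> gives the wrap-around.\<close>

lemma precedes_elem_at:
  assumes "finite I" and j: "j \<in> {1..card I}"
  shows "precedes I (elem_at I j) (elem_at I (cyclic_shift (card I) j))"
proof -
  let ?e = "elem_at I" and ?k = "card I"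
  have img: "?e ` {1..?k} = I"
    using elem_at_bij[OF assms(1)] by (simp add: bij_betw_def)
  have index: "\<exists>m. 1 \<le> m \<and> m \<le> ?k \<and> x = ?e m" if "x \<in> I" for x
    using that img by (metis atLeastAtMost_iff imageE)
  have mono: "?e a \<le> ?e b" if "1 \<le> a" "a \<le> b" "b \<le> ?k" for a b
    using elem_at_less[of a b I] that by (cases "a = b") auto
  have mem: "?e a \<in> I" if "1 \<le> a" "a \<le> ?k" for a
    using img that by auto
  show ?thesis
  proof (cases "j < ?k")
    case True
    have "x \<le> ?e j \<or> ?e (Suc j) \<le> x" if "x \<in> I" for x
    proof -
      obtain m where m: "1 \<le> m" "m \<le> ?k" "x = ?e m"
        using index[OF \<open>x \<in> I\<close>] by blast
      show ?thesis
        using mono[of m j] mono[of "Suc j" m] m True by (cases "m \<le> j") auto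
    qed
    moreover have "?e j < ?e (Suc j)" "?e j \<in> I" "?e (Suc j) \<in> I"
      using True j by (auto intro: elem_at_less mem)
    ultimately show ?thesis
      using True j by (simp add: precedes_def cyclic_shift_def)
  next
    case False
    then have "j = ?k"
      using j by simp
    moreover have "?e 1 \<le> x \<and> x \<le> ?e ?k" if "x \<in> I" for x
    proof -
      obtain m where "1 \<le> m" "m \<le> ?k" "x = ?e m"
        using index[OF \<open>x \<in> I\<close>] by blast
      then show ?thesis
        using mono[of 1 m] mono[of m ?k] by auto
    qed
    moreover have "?e 1 \<in> I" "?e ?k \<in> I"
      using j by (auto intro: mem)
    moreover have "cyclic_shift ?k j = 1"
      using False j by (simp add: cyclic_shift_def)
    ultimately show ?thesis
      by (simp add: precedes_def)
  qed
qed

lemma next_guess_cyclic_shift: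
  "next_guess n cyclic_shift \<pi> g = g \<circ> cyclic_pred (incorrect n \<pi> g)"
proof
  fix i
  let ?I = "incorrect n \<pi> g"
  let ?s = "cyclic_shift (card ?I)"
  have fin: "finite ?I"
    by (simp add: incorrect_def)
  have "card ?I \<le> n"
    using card_mono[of "{1..n}" ?I] by (auto simp: incorrect_def)
  \<comment> \<open>\<open>strategy\<close> is silent about \<open>k = 0\<close>, where the shift is
    the identity.\<close>
  then have S: "?s permutes {1..card ?I}"
    using strategy_cyclic_shift[of n] unfolding strategy_def
    by (cases "card ?I = 0") (auto simp: cyclic_shift_def permutes_def)
  show "next_guess n cyclic_shift \<pi> g i = (g \<circ> cyclic_pred ?I) i"
  proof (cases "i \<in> ?I")
    case True
    have "(elem_at ?I \<circ> ?s) ` {1..card ?I} = ?I"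
      using elem_at_bij[OF fin] permutes_image[OF S] unfolding image_comp[symmetric]
      by (simp only: bij_betw_def)
    with True have "i \<in> (elem_at ?I \<circ> ?s) ` {1..card ?I}"
      by (simp only:)
    then obtain j where j: "j \<in> {1..card ?I}" "i = elem_at ?I (?s j)"
      unfolding image_comp[symmetric] by blast
    show ?thesis
      unfolding j(2) comp_apply cyclic_pred_eq[OF fin precedes_elem_at[OF fin j(1)]]
      by (rule next_guess_incorrect[where S = cyclic_shift, OF S j(1)])
  next
    case False
    then show ?thesis
      by (simp add: next_guess_def Let_def cyclic_pred_outside)
  qed
qed

section \<open>Secrets first touched by guess two and found by guess three\<close>

lemma incorrect_eq: "incorrect n \<pi> g = {i \<in> {1..n}. g i \<noteq> \<pi> i}"
  by (auto simp: incorrect_def correct_def)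

lemma correct_full_iff:
  assumes "\<pi> permutes {1..n}" "g permutes {1..n}"
  shows "correct n \<pi> g = {1..n} \<longleftrightarrow> \<pi> = g"
proof
  assume full: "correct n \<pi> g = {1..n}"
  have inside: "\<pi> i = g i" if "i \<in> {1..n}" for i
    using that unfolding full[symmetric] by (simp add: correct_def)
  show "\<pi> = g"
  proof
    show "\<pi> i = g i" for i
      using inside permutes_not_in[OF assms(1)] permutes_not_in[OF assms(2)]
      by (cases "i \<in> {1..n}") simp_all
  qed
qed (auto simp: correct_def)

text \<open>For a secret without fixed points every position of the first guess is wrong, so
  \<open>c\<close> is the second guess. That guess has a hit but is not final iff its incorrect set
  is neither full nor empty, and the equation says that the third guess is the secret.\<close>

lemma third_guess_iff:
  fixes n :: nat
  defines "c \<equiv> cyclic_pred {1..n}"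
  assumes n: "n \<ge> 1" and \<pi>: "\<pi> permutes {1..n}"
  shows "ends_after n cyclic_shift \<pi> 3 \<and> rho n cyclic_shift \<pi> = 2 \<longleftrightarrow>
     (\<forall>i\<in>{1..n}. \<pi> i \<noteq> i) \<and> incorrect n \<pi> c \<notin> {{}, {1..n}} \<and>
     \<pi> = c \<circ> cyclic_pred (incorrect n \<pi> c)"
    (is "?L \<longleftrightarrow> ?R")
proof -
  let ?G = "guess n cyclic_shift \<pi>" and ?I = "incorrect n \<pi> c"
  have g1: "?G 1 = id"
    by (simp add: guess_def)
  have g2: "?G 2 = c" if "\<forall>i\<in>{1..n}. \<pi> i \<noteq> i"
  proof -
    have "incorrect n \<pi> id = {1..n}"
      using that by (auto simp: incorrect_eq)
    then show ?thesis
      by (simp add: guess_def next_guess_cyclic_shift c_def)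
  qed
  have g3: "?G 3 = c \<circ> cyclic_pred ?I" if "\<forall>i\<in>{1..n}. \<pi> i \<noteq> i"
  proof -
    have "?G 3 = next_guess n cyclic_shift \<pi> (?G 2)"
      by (simp add: guess_def numeral_3_eq_3 numeral_2_eq_2)
    then show ?thesis
      using g2[OF that] by (simp add: next_guess_cyclic_shift)
  qed
  have perm: "c \<circ> cyclic_pred ?I permutes {1..n}"
  proof (rule permutes_compose)
    show "cyclic_pred ?I permutes {1..n}"
      by (rule permutes_subset[OF cyclic_pred_permutes]) (auto simp: incorrect_eq)
  qed (simp add: c_def cyclic_pred_permutes)
  have corr: "correct n \<pi> c = {} \<longleftrightarrow> ?I = {1..n}" "correct n \<pi> c = {1..n} \<longleftrightarrow> ?I = {}"
    unfolding incorrect_def correct_def by blast+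
  have nofix: "correct n \<pi> (?G 1) = {} \<longleftrightarrow> (\<forall>i\<in>{1..n}. \<pi> i \<noteq> i)"
    unfolding g1 correct_def id_apply by (blast dest: sym)
  have less3: "1 \<le> s \<and> s < 3 \<longleftrightarrow> s = 1 \<or> s = 2" for s :: nat
    by auto
  define P where "P r \<longleftrightarrow> 1 \<le> r \<and> correct n \<pi> (?G r) \<noteq> {}" for r
  have rho: "rho n cyclic_shift \<pi> = (LEAST r. P r)"
    by (simp add: rho_def P_def)
  show ?thesis
  proof
    assume L: ?L
    \<comment> \<open>The final guess has an entry because \<open>n >= 1\<close>, so the
      \<open>LEAST\<close> in \<open>rho\<close> is attained.\<close>
    then have "P 3"
      using n by (auto simp: ends_after_def P_def)
    then have "P 2"
      using L rho by (metis LeastI)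
    have "\<not> P 1"
      using L rho not_less_Least[of 1 P] by simp
    then have nf: "\<forall>i\<in>{1..n}. \<pi> i \<noteq> i"
      using nofix by (simp add: P_def)
    then show ?R
      using \<open>P 2\<close> L g2[OF nf] g3[OF nf] corr correct_full_iff[OF \<pi> perm]
      by (auto simp: P_def ends_after_def)
  next
    assume R: ?R
    then have nf: "\<forall>i\<in>{1..n}. \<pi> i \<noteq> i"
      by blast
    then have "\<not> P 1"
      using nofix by (simp add: P_def)
    moreover have "P 2"
      using R corr g2[OF nf] by (simp add: P_def)
    ultimately have "rho n cyclic_shift \<pi> = 2"
      unfolding rho
      by (intro Least_equality) (auto simp: P_def numeral_2_eq_2 not_less_eq_eq dest: le_antisym)
    moreover have "correct n \<pi> (?G 1) \<noteq> {1..n}"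
      using nf nofix n by (metis atLeastatMost_empty_iff2 not_less)
    moreover have "correct n \<pi> (?G 3) = {1..n}"
      unfolding g3[OF nf] using R correct_full_iff[OF \<pi> perm] by blast
    moreover have "correct n \<pi> (?G 2) \<noteq> {1..n}"
      unfolding g2[OF nf] using R corr by blast
    ultimately show ?L
      unfolding ends_after_def less3 by auto
  qed
qed

section \<open>Excluded sets and their number\<close>

definition neighbour_pairs :: "nat \<Rightarrow> nat set set" where
  "neighbour_pairs n = (\<lambda>i. {i, cyclic_pred {1..n} i}) ` {1..n}"

definition bad_sets :: "nat \<Rightarrow> nat set set" where
  "bad_sets n = {{}, {1..n}} \<union> (\<lambda>i. {i}) ` {1..n} \<union> neighbour_pairs n"

text \<open>Two different points yielding the same pair would be predecessors of each other, which
  happens only in a cycle of length 2.\<close>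

lemma card_neighbour_pairs:
  assumes "n \<ge> 3"
  shows "card (neighbour_pairs n) = n"
proof -
  have "inj_on (\<lambda>i. {i, cyclic_pred {1..n} i}) {1..n}"
  proof (rule inj_onI)
    fix i j assume "i \<in> {1..n}" "j \<in> {1..n}"
      "{i, cyclic_pred {1..n} i} = {j, cyclic_pred {1..n} j}"
    then show "i = j"
      using assms by (auto simp: cyclic_pred_interval doubleton_eq_iff split: if_splits)
  qed
  then show ?thesis
    by (simp add: neighbour_pairs_def card_image)
qed

lemma card_neighbour_pair:
  assumes "n \<ge> 2" "I \<in> neighbour_pairs n"
  shows "card I = 2"
  using assms by (auto simp: neighbour_pairs_def cyclic_pred_interval)

lemma card_bad_sets:
  assumes "n \<ge> 3"
  shows "card (bad_sets n) = 2 * n + 2"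
proof -
  let ?s = "(\<lambda>i. {i}) ` {1..n}"
  have "card {{}, {1..n}} = 2" "card ?s = n"
    using assms by (auto simp: card_image)
  moreover have "{{}, {1..n}} \<inter> ?s = {}"
    using assms by (auto simp: atLeastAtMost_singleton_iff)
  ultimately have "card ({{}, {1..n}} \<union> ?s) = n + 2"
    by (subst card_Un_disjoint) auto
  \<comment> \<open>The sizes here are 0, \<open>n\<close> and 1, and \<open>n >= 3\<close>.\<close>
  moreover have "card I \<noteq> 2" if "I \<in> {{}, {1..n}} \<union> ?s" for I
    using that assms by auto
  then have "({{}, {1..n}} \<union> ?s) \<inter> neighbour_pairs n = {}"
    using assms card_neighbour_pair[of n] by fastforce
  ultimately show ?thesis
    unfolding bad_sets_def using card_neighbour_pairs[OF assms]
    by (subst card_Un_disjoint) (auto simp: neighbour_pairs_def)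
qed

lemma bad_sets_subset: "n \<ge> 1 \<Longrightarrow> bad_sets n \<subseteq> Pow {1..n}"
  by (auto simp: bad_sets_def neighbour_pairs_def cyclic_pred_interval split: if_splits)

text \<open>Since \<open>c\<close> moves every point, a fixed point \<open>i\<close> lies in
  \<open>I\<close>. Its predecessor \<open>p\<close> in \<open>I\<close> has \<open>i\<close> as its
  own predecessor in the full cycle, which leaves no room for a third element of \<open>I\<close>.
  Conversely, on a pair \<open>{p, c p}\<close> a fixed-point-free \<open>cyclic_pred I\<close> must
  be the swap.\<close>

lemma composite_fixpoint_iff:
  fixes n :: nat
  defines "c \<equiv> cyclic_pred {1..n}"
  assumes n: "n \<ge> 2" and I: "I \<subseteq> {1..n}" "\<forall>i\<in>I. cyclic_pred I i \<noteq> i"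
  shows "(\<exists>i\<in>{1..n}. c (cyclic_pred I i) = i) \<longleftrightarrow> I \<in> neighbour_pairs n"
proof
  have fin: "finite I"
    using I finite_subset by blast
  have c_neq: "c i \<noteq> i" if "i \<in> {1..n}" for i
    using that n by (auto simp: c_def cyclic_pred_interval)
  {
    assume "\<exists>i\<in>{1..n}. c (cyclic_pred I i) = i"
    then obtain i where i: "i \<in> {1..n}" "c (cyclic_pred I i) = i"
      by blast
    define p where "p = cyclic_pred I i"
    have iI: "i \<in> I"
      using i c_neq cyclic_pred_outside by metis
    have pre: "precedes I p i"
      using precedes_cyclic_pred[OF fin iI] by (simp add: p_def)
    then have p: "p \<in> I" "p \<in> {1..n}"
      using I by (auto simp: precedes_def)
    have ip: "i = (if p = 1 then n else p - 1)"
      using i cyclic_pred_interval[OF p(2)] by (simp add: c_def p_def)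
    \<comment> \<open>If \<open>p = 1\<close>, then \<open>i = n\<close> and no element of
      \<open>I\<close> lies strictly between them. Otherwise \<open>i = p - 1 < p\<close>, so
      \<open>precedes\<close> is in its wrap-around case and \<open>I\<close> lies between
      \<open>p - 1\<close> and \<open>p\<close>.\<close>
    have "x \<in> {p, i}" if "x \<in> I" for x
    proof (cases "p = 1")
      case True
      then have "x \<le> 1 \<or> n \<le> x"
        using pre ip that n iI by (auto simp: precedes_def)
      moreover have "1 \<le> x" "x \<le> n"
        using I that by auto
      ultimately show ?thesis
        using True ip by auto
    next
      case False
      then have "i \<le> x \<and> x \<le> p"
        using pre ip that p by (auto simp: precedes_def)
      then show ?thesis
        using False ip by auto
    qed
    then have "I = {p, c p}"
      using p iI i by (auto simp: p_def)
    then show "I \<in> neighbour_pairs n"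
      using p by (auto simp: neighbour_pairs_def c_def)
  }
  {
    assume "I \<in> neighbour_pairs n"
    then obtain p where p: "p \<in> {1..n}" "I = {p, c p}"
      by (auto simp: neighbour_pairs_def c_def)
    have "cyclic_pred I (c p) \<in> I"
      using p permutes_in_image[OF cyclic_pred_permutes[OF fin]] by blast
    then have "cyclic_pred I (c p) = p"
      using I p by auto
    then show "\<exists>i\<in>{1..n}. c (cyclic_pred I i) = i"
      using p I by (intro bexI[of _ "c p"]) auto
  }
qed

lemma admissible_iff:
  fixes n :: nat
  defines "c \<equiv> cyclic_pred {1..n}"
  assumes n: "n \<ge> 2" and I: "I \<subseteq> {1..n}"
  shows "I \<notin> bad_sets n \<longleftrightarrow> I \<notin> {{}, {1..n}} \<and> (\<forall>i\<in>I. cyclic_pred I i \<noteq> i) \<and>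
     (\<forall>i\<in>{1..n}. c (cyclic_pred I i) \<noteq> i)"
proof -
  have "finite I"
    using I finite_subset by blast
  then have "I = {i}" if "i \<in> I" "cyclic_pred I i = i" for i
    using that by (intro cyclic_pred_fixpoint_imp_singleton)
  moreover have "cyclic_pred I i = i" if "I = {i}" for i
    using that by (simp add: cyclic_pred_singleton)
  ultimately have "(\<forall>i\<in>I. cyclic_pred I i \<noteq> i) \<longleftrightarrow> I \<notin> (\<lambda>i. {i}) ` {1..n}"
    using I by blast
  \<comment> \<open>The pair criterion presupposes that singletons are already excluded; inside the
    conjunction this is enough.\<close>
  moreover have "(\<forall>i\<in>{1..n}. c (cyclic_pred I i) \<noteq> i) \<longleftrightarrow> I \<notin> neighbour_pairs n"
    if "\<forall>i\<in>I. cyclic_pred I i \<noteq> i"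
    using composite_fixpoint_iff[OF n I that] unfolding c_def by blast
  ultimately show ?thesis
    unfolding bad_sets_def by blast
qed

text \<open>Cancel the injective \<open>c\<close>. Thus \<open>I\<close> can be read off from the
  composite exactly when \<open>cyclic_pred I\<close> moves every point of \<open>I\<close>.\<close>

lemma incorrect_composite:
  fixes n :: nat
  defines "c \<equiv> cyclic_pred {1..n}"
  assumes "I \<subseteq> {1..n}"
  shows "incorrect n (c \<circ> cyclic_pred I) c = {i \<in> I. cyclic_pred I i \<noteq> i}"
proof -
  have "inj c"
    unfolding c_def by (intro permutes_inj[OF cyclic_pred_permutes]) simp
  then show ?thesis
    using assms(2) cyclic_pred_outside[of _ I] by (auto simp: incorrect_eq inj_eq) metis
qed

theorem theorem4p7:
  fixes n :: nat
  assumes "n \<ge> 4"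
  shows "int (card {\<pi>. \<pi> permutes {1..n} \<and> ends_after n cyclic_shift \<pi> 3 \<and>
                        rho n cyclic_shift \<pi> = 2}) = 2 ^ n - 2 * int n - 2"
proof -
  let ?A = "{\<pi>. \<pi> permutes {1..n} \<and> ends_after n cyclic_shift \<pi> 3 \<and> rho n cyclic_shift \<pi> = 2}"
  define c where "c = cyclic_pred {1..n}"
  let ?B = "Pow {1..n} - bad_sets n"
  let ?I = "\<lambda>\<pi>. incorrect n \<pi> c" and ?F = "\<lambda>I. c \<circ> cyclic_pred I"
  have n: "1 \<le> n" "2 \<le> n"
    using assms by auto
  have sub: "?I \<pi> \<subseteq> {1..n}" for \<pi>
    by (auto simp: incorrect_eq)
  have A: "\<pi> \<in> ?A \<longleftrightarrow> \<pi> permutes {1..n} \<and> (\<forall>i\<in>{1..n}. \<pi> i \<noteq> i) \<and>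
      ?I \<pi> \<notin> {{}, {1..n}} \<and> \<pi> = ?F (?I \<pi>)" for \<pi>
    using third_guess_iff[OF n(1), of \<pi>] unfolding c_def by blast
  have B: "I \<in> ?B \<longleftrightarrow> I \<subseteq> {1..n} \<and> I \<notin> {{}, {1..n}} \<and> (\<forall>i\<in>I. cyclic_pred I i \<noteq> i) \<and>
      (\<forall>i\<in>{1..n}. ?F I i \<noteq> i)" for I
    using admissible_iff[OF n(2), of I] unfolding c_def by auto
  have IF: "?I (?F I) = I" if "I \<in> ?B" for I
    using that incorrect_composite[of I n] unfolding B c_def by auto
  have perm: "?F I permutes {1..n}" if "I \<subseteq> {1..n}" for I
    unfolding c_def using that finite_subset[OF that]
    by (intro permutes_compose permutes_subset[OF cyclic_pred_permutes that] cyclic_pred_permutes) auto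
  have "bij_betw ?I ?A ?B"
  proof (rule bij_betw_byWitness[where f' = ?F])
    show "\<forall>\<pi>\<in>?A. ?F (?I \<pi>) = \<pi>"
      by (rule ballI, drule iffD1[OF A], elim conjE, erule sym)
    show "\<forall>I\<in>?B. ?I (?F I) = I"
      using IF by blast
    show "?I ` ?A \<subseteq> ?B"
    proof (rule image_subsetI)
      fix \<pi> assume "\<pi> \<in> ?A"
      from iffD1[OF A this]
      have \<pi>: "\<forall>i\<in>{1..n}. \<pi> i \<noteq> i" "?I \<pi> \<notin> {{}, {1..n}}" "\<pi> = ?F (?I \<pi>)"
        by blast+
      \<comment> \<open>Rewriting the secret as \<open>?F (?I \<pi>)\<close> expresses its incorrect
        set as the set of its own moved points, so none of them is fixed.\<close>
      have "?I \<pi> = {i \<in> ?I \<pi>. cyclic_pred (?I \<pi>) i \<noteq> i}"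
        using incorrect_composite[OF sub] \<pi>(3) unfolding c_def by metis
      then have "\<forall>i\<in>?I \<pi>. cyclic_pred (?I \<pi>) i \<noteq> i"
        by blast
      then show "?I \<pi> \<in> ?B"
        unfolding B \<pi>(3)[symmetric] using \<pi>(1,2) sub by blast
    qed
    show "?F ` ?B \<subseteq> ?A"
    proof (rule image_subsetI)
      fix I assume I: "I \<in> ?B"
      show "?F I \<in> ?A"
        unfolding A IF[OF I] using iffD1[OF B I] perm[of I] by blast
    qed
  qed
  then have "card ?A = card ?B"
    by (rule bij_betw_same_card)
  also have "\<dots> = 2 ^ n - (2 * n + 2)"
    using bad_sets_subset[OF n(1)] card_bad_sets[of n] assms
    by (simp add: card_Diff_subset finite_subset card_Pow)
  finally have "card ?A = 2 ^ n - (2 * n + 2)" .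
  \<comment> \<open>The subtraction so far is truncated; this bound carries it over to the
    integers.\<close>
  moreover have "2 * n + 2 \<le> 2 ^ n"
    using card_mono[OF _ bad_sets_subset[OF n(1)]] card_bad_sets[of n] assms by (simp add: card_Pow)
  ultimately show ?thesis
    by (simp add: of_nat_diff)
qed

end
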